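(* Let $\mathbf{p}=\{p_1,\dots,p_n\}$ and $\mathbf{r}=\{r_1,\dots,r_n\}$ be two probability distributions with $p_j>0$ and $r_j>0$ for all $j=1,\dots,n$, and let $0<q<1$. Then $$q\sum_{j=1}^n\frac{(p_j-r_j)^2}{\max\{p_j,r_j\}}\le J_q(\mathbf{p}|\mathbf{r})\le q\sum_{j=1}^n\frac{(p_j-r_j)^2}{\min\{p_j,r_j\}}.$$
   Context: A probability distribution satisfies $\sum_j p_j=1$. For probability distributions $\mathbf{p},\mathbf{r}$ with positive entries and $q>0$, $q\ne1$, the Tsallis divergence is $D_q^T(\mathbf{p}|\mathbf{r}):=\sum_{j=1}^n\frac{p_j-p_j^qr_j^{1-q}}{1-q}$, and the Jeffreys-Tsallis divergence is $J_q(\mathbf{p}|\mathbf{r}):=D_q^T(\mathbf{p}|\mathbf{r})+D_q^T(\mathbf{r}|\mathbf{p})$. *)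

theory Defs
  imports Complex_Main
begin

(* A distribution (p_1, ..., p_n) is a function on nat of which only the values
   at 1, ..., n matter. *)

definition prob_distribution :: "nat \<Rightarrow> (nat \<Rightarrow> real) \<Rightarrow> bool" where
  "prob_distribution n p \<longleftrightarrow> (\<forall>j\<in>{1..n}. 0 \<le> p j) \<and> (\<Sum>j=1..n. p j) = 1"

(* Intended for positive entries, q > 0 and q \<noteq> 1; at q = 1 the division
   convention of HOL makes it 0, not the Kullback-Leibler divergence. *)

definition tsallis_divergence :: "nat \<Rightarrow> real \<Rightarrow> (nat \<Rightarrow> real) \<Rightarrow> (nat \<Rightarrow> real) \<Rightarrow> real" where
  "tsallis_divergence n q p r =
     (\<Sum>j=1..n. (p j - p j powr q * r j powr (1 - q)) / (1 - q))"

definition jeffreys_tsallis_divergence :: "nat \<Rightarrow> real \<Rightarrow> (nat \<Rightarrow> real) \<Rightarrow> (nat \<Rightarrow> real) \<Rightarrow> real" where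
  "jeffreys_tsallis_divergence n q p r =
     tsallis_divergence n q p r + tsallis_divergence n q r p"

end

theory Submission
  imports Defs
begin

text \<open>
  The inequality holds for each index separately. For positive \<open>x\<close> and \<open>y\<close>, the summand of
  the Jeffreys-Tsallis divergence factors as
  \<open>(x powr q - y powr q) * (x powr (1 - q) - y powr (1 - q)) / (1 - q)\<close>.
  By symmetry let \<open>y \<le> x\<close>. For an exponent between \<open>0\<close> and \<open>1\<close> the power function is concave,
  so its increment from \<open>y\<close> to \<open>x\<close> lies between the increments of the tangents at \<open>x\<close> and at \<open>y\<close>.
  Multiplying these bounds for the exponents \<open>q\<close> and \<open>1 - q\<close>, the powers in the two slopes
  \<open>q * z powr (q - 1)\<close> and \<open>(1 - q) * z powr (- q)\<close> combine to \<open>1 / z\<close>. The choice \<open>z = x\<close>, the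
  maximum, gives the lower bound and \<open>z = y\<close>, the minimum, the upper one.
\<close>

text \<open>
  Concavity: the graph lies below the tangent at \<open>y\<close>. The position of \<open>x\<close> relative to \<open>y\<close> is
  left open, so that exchanging the variables turns the upper bound for an increment into the
  lower one.
\<close>

lemma powr_diff_le_tangent:
  fixes x y a :: real
  assumes "0 < x" "0 < y" "0 \<le> a" "a \<le> 1"
  shows "x powr a - y powr a \<le> a * y powr (a - 1) * (x - y)"
proof -
  have mono: "s powr (a - 1) \<le> t powr (a - 1)" if "0 < t" "t \<le> s" for s t :: real
    using powr_mono2'[of "a - 1" t s] that assms by simp
  have deriv: "((\<lambda>z. z powr a) has_real_derivative a * z powr (a - 1)) (at z)"
    if "0 < z" for z :: real
    using that by (rule has_real_derivative_powr)
  consider "x = y" | "y < x" | "x < y" by linarith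
  then show ?thesis
  proof cases
    case 1
    then show ?thesis by simp
  next
    case 2
    obtain z where z: "y < z" "z < x"
      and eq: "x powr a - y powr a = (x - y) * (a * z powr (a - 1))"
      using MVT2[of y x "\<lambda>z. z powr a" "\<lambda>z. a * z powr (a - 1)"] 2 assms deriv
      by fastforce
    have "(x - y) * (a * z powr (a - 1)) \<le> (x - y) * (a * y powr (a - 1))"
      using z assms by (intro mult_left_mono mono) auto
    then show ?thesis using eq by (simp add: mult_ac)
  next
    case 3
    obtain z where z: "x < z" "z < y"
      and eq: "y powr a - x powr a = (y - x) * (a * z powr (a - 1))"
      using MVT2[of x y "\<lambda>z. z powr a" "\<lambda>z. a * z powr (a - 1)"] 3 assms deriv
      by fastforce
    have "(y - x) * (a * y powr (a - 1)) \<le> (y - x) * (a * z powr (a - 1))"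
      using z assms by (intro mult_left_mono mono) auto
    then show ?thesis using eq by (simp add: algebra_simps)
  qed
qed

lemma tangent_slopes_mult:
  fixes q z d :: real
  assumes "0 < z"
  shows "(q * z powr (q - 1) * d) * ((1 - q) * z powr ((1 - q) - 1) * d)
    = (1 - q) * (q * (d\<^sup>2 / z))"
proof -
  have "z powr (q - 1) * z powr ((1 - q) - 1) = 1 / z"
    using assms by (simp add: powr_diff powr_minus_divide)
  then have "(q * z powr (q - 1) * d) * ((1 - q) * z powr ((1 - q) - 1) * d)
      = (1 - q) * q * d\<^sup>2 * (1 / z)"
    by (metis (no_types, lifting) mult.assoc mult.commute mult.left_commute power2_eq_square)
  then show ?thesis by simp
qed

definition jeffreys_tsallis_term :: "real \<Rightarrow> real \<Rightarrow> real \<Rightarrow> real" where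
  "jeffreys_tsallis_term q x y =
     (x - x powr q * y powr (1 - q)) / (1 - q) + (y - y powr q * x powr (1 - q)) / (1 - q)"

lemma jeffreys_tsallis_divergence_eq_sum:
  "jeffreys_tsallis_divergence n q p r = (\<Sum>j=1..n. jeffreys_tsallis_term q (p j) (r j))"
  by (simp add: jeffreys_tsallis_divergence_def tsallis_divergence_def
      jeffreys_tsallis_term_def sum.distrib)

lemma jeffreys_tsallis_term_commute:
  "jeffreys_tsallis_term q x y = jeffreys_tsallis_term q y x"
  by (simp add: jeffreys_tsallis_term_def)

text \<open>The products \<open>x powr q * x powr (1 - q)\<close> that arise on expanding collapse to \<open>x\<close>.\<close>

lemma jeffreys_tsallis_term_factor:
  assumes "0 < x" "0 < y"
  shows "jeffreys_tsallis_term q x y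
    = (x powr q - y powr q) * (x powr (1 - q) - y powr (1 - q)) / (1 - q)"
proof -
  have "x powr q * x powr (1 - q) = x" "y powr q * y powr (1 - q) = y"
    using assms by (simp_all add: powr_add[symmetric])
  then show ?thesis
    by (simp add: jeffreys_tsallis_term_def add_divide_distrib[symmetric] algebra_simps)
qed

lemma jeffreys_tsallis_term_bounds_ordered:
  fixes x y q :: real
  assumes "0 < y" "y \<le> x" "0 < q" "q < 1"
  shows "q * ((x - y)\<^sup>2 / x) \<le> jeffreys_tsallis_term q x y"
    and "jeffreys_tsallis_term q x y \<le> q * ((x - y)\<^sup>2 / y)"
proof -
  define A where "A = x powr q - y powr q"
  define B where "B = x powr (1 - q) - y powr (1 - q)"
  have x: "0 < x" using assms by linarith
  have nonneg: "0 \<le> A" "0 \<le> B"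
    using assms by (simp_all add: A_def B_def powr_mono2)
  have upper: "A \<le> q * y powr (q - 1) * (x - y)"
      "B \<le> (1 - q) * y powr ((1 - q) - 1) * (x - y)"
    unfolding A_def B_def using assms x by (intro powr_diff_le_tangent; simp)+
  have lower: "q * x powr (q - 1) * (x - y) \<le> A"
      "(1 - q) * x powr ((1 - q) - 1) * (x - y) \<le> B"
    using powr_diff_le_tangent[of y x q] powr_diff_le_tangent[of y x "1 - q"] assms x
    by (simp_all add: A_def B_def algebra_simps)
  have "(1 - q) * (q * ((x - y)\<^sup>2 / x)) \<le> A * B"
    unfolding tangent_slopes_mult[OF x, symmetric]
    using assms nonneg by (intro mult_mono lower) auto
  moreover have "A * B \<le> (1 - q) * (q * ((x - y)\<^sup>2 / y))"
    unfolding tangent_slopes_mult[OF assms(1), symmetric]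
    using assms nonneg by (intro mult_mono upper) auto
  moreover have "jeffreys_tsallis_term q x y = A * B / (1 - q)"
    using jeffreys_tsallis_term_factor[OF x assms(1)] by (simp add: A_def B_def)
  ultimately show "q * ((x - y)\<^sup>2 / x) \<le> jeffreys_tsallis_term q x y"
      "jeffreys_tsallis_term q x y \<le> q * ((x - y)\<^sup>2 / y)"
    using assms by (simp_all add: pos_le_divide_eq pos_divide_le_eq mult.commute)
qed

lemma jeffreys_tsallis_term_bounds:
  fixes x y q :: real
  assumes "0 < x" "0 < y" "0 < q" "q < 1"
  shows "q * ((x - y)\<^sup>2 / max x y) \<le> jeffreys_tsallis_term q x y"
    and "jeffreys_tsallis_term q x y \<le> q * ((x - y)\<^sup>2 / min x y)"
proof -
  have "q * ((x - y)\<^sup>2 / max x y) \<le> jeffreys_tsallis_term q x y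
      \<and> jeffreys_tsallis_term q x y \<le> q * ((x - y)\<^sup>2 / min x y)"
  proof (cases "y \<le> x")
    case True
    then show ?thesis
      using jeffreys_tsallis_term_bounds_ordered[of y x q] assms
      by (simp add: max_absorb1 min_absorb2)
  next
    case False
    then show ?thesis
      using jeffreys_tsallis_term_bounds_ordered[of x y q] assms
      by (simp add: max_def min_def power2_commute[of x y] jeffreys_tsallis_term_commute[of q x y])
  qed
  then show "q * ((x - y)\<^sup>2 / max x y) \<le> jeffreys_tsallis_term q x y"
      "jeffreys_tsallis_term q x y \<le> q * ((x - y)\<^sup>2 / min x y)"
    by blast+
qed

theorem theorem3p1:
  fixes n :: nat and p r :: "nat \<Rightarrow> real" and q :: real
  assumes "prob_distribution n p" and "prob_distribution n r"
    and "\<And>j. j \<in> {1..n} \<Longrightarrow> 0 < p j" and "\<And>j. j \<in> {1..n} \<Longrightarrow> 0 < r j"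
    and "0 < q" and "q < 1"
  shows "q * (\<Sum>j=1..n. (p j - r j)\<^sup>2 / max (p j) (r j)) \<le> jeffreys_tsallis_divergence n q p r
    \<and> jeffreys_tsallis_divergence n q p r \<le> q * (\<Sum>j=1..n. (p j - r j)\<^sup>2 / min (p j) (r j))"
  unfolding jeffreys_tsallis_divergence_eq_sum sum_distrib_left
  using assms(3-6) by (intro conjI sum_mono jeffreys_tsallis_term_bounds) auto

end
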